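(* Let $n\ge2$, $j\ge1$, $j\not\equiv0\pmod n$. Let $u=\sum_{i=1}^{n-1}u_ie_{in}:\mathbb{R}^2\to V_n$ be a smooth solution of the $j$-th $A^{(1)}_{n-1}$-KdV flow $u_t=[\partial_x+b+u,Z_{j,0}(u)]$, and let $c_0\in SL(n,\mathbb{R})$ be a constant. Let $g:\mathbb{R}^2\to SL(n,\mathbb{R})$ be the solution of $g^{-1}g_x=b+u$, $g^{-1}g_t=Z_{j,0}(u)$, $g(0,0)=c_0$. Then $\gamma(x,t):=g(x,t)e_1$ is a solution of the $j$-th central affine curve flow $\gamma_t=gZ_{j,0}(u)e_1$ on $\mathcal{M}_n(\mathbb{R})$, with central affine curvature $u(\cdot,t)$ for each $t$.
   Context: $\mathcal{M}_n(\mathbb{R})$ is the set of smooth $\gamma:\mathbb{R}\to\mathbb{R}^n\setminus\{0\}$ with $\det(\gamma,\gamma_x,\ldots,\gamma_x^{(n-1)})=1$. For such $\gamma$ the central affine moving frame $g=(\gamma,\ldots,\gamma_x^{(n-1)})$ satisfies $g_x=g(b+u)$ with $b=\sum_{i=1}^{n-1}e_{i+1,i}$ and $u=\sum_{i=1}^{n-1}u_ie_{in}$, where $\gamma_x^{(n)}=u_1\gamma+\cdots+u_{n-1}\gamma_x^{(n-2)}$; $u$ is the central affine curvature. $V_n=\bigoplus_{i=1}^{n-1}\mathbb{R}e_{in}$, $e_1=(1,0,\ldots,0)^t$. The $j$-th central affine curve flow is $\gamma_t=gZ_{j,0}(u)e_1$ for $\gamma(\cdot,t)\in\mathcal{M}_n(\mathbb{R})$,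 with $g(\cdot,t)$, $u(\cdot,t)$ the moving frame and curvature of $\gamma(\cdot,t)$. Let $J=e_{1n}\lambda+b$. For smooth $V_n$-valued $u$, let $Y(u,\lambda)=e_{1n}\lambda+\sum_{i\le 0}Y_{1,i}(u)\lambda^i$ be the unique formal series with smooth $sl(n)$-valued coefficients satisfying $Y_x+[J+u,Y]=0$ and $Y^n=\lambda I_n$; its coefficients are differential polynomials in $u$ (in the variable $x$). Write $Y(u,\lambda)^j=\sum_i Y_{j,i}(u)\lambda^i$. There is a unique strictly upper triangular $\zeta_j(u)$ (entries differential polynomials in $u$) with $[\partial_x+b+u,\,Y_{j,0}(u)-\zeta_j(u)]\in V_n$, where $[\partial_x+A,B]=B_x+[A,B]$. Set $Z_{j,0}(u)=Y_{j,0}(u)-\zeta_j(u)$. *)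

theory Defs
  imports
    "HOL-Analysis.Derivative"
    "HOL-Computational_Algebra.Formal_Laurent_Series"
    "Jordan_Normal_Form.Determinant"
begin

no_notation fls_nth (infixl \<open>$$\<close> 75)
no_notation fps_nth (infixl \<open>$\<close> 75)

text \<open>
  Matrices and vectors are indexed from 0, so the mathematical entry \<open>(i, k)\<close> with
  \<open>1 \<le> i, k \<le> n\<close> is the entry \<open>(i - 1, k - 1)\<close> here.
\<close>

section \<open>Smoothness and derivatives\<close>

definition smooth :: "(real \<Rightarrow> real) \<Rightarrow> bool" where
  "smooth f \<longleftrightarrow> (\<forall>k x. (deriv ^^ k) f differentiable (at x))"

text \<open>
  Smoothness on the plane: the largest class of continuous functions whose two partial
  derivatives exist everywhere and belong to the class again, i.e. all iterated partial
  derivatives exist and are continuous.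
\<close>

coinductive smooth2 :: "(real \<Rightarrow> real \<Rightarrow> real) \<Rightarrow> bool" where
  "\<lbrakk>continuous_on UNIV (\<lambda>(x, t). f x t);
    \<And>x t. ((\<lambda>s. f s t) has_real_derivative fx x t) (at x);
    \<And>x t. ((\<lambda>s. f x s) has_real_derivative ft x t) (at t);
    smooth2 fx; smooth2 ft\<rbrakk> \<Longrightarrow> smooth2 f"

definition smooth_mat :: "nat \<Rightarrow> (real \<Rightarrow> real mat) \<Rightarrow> bool" where
  "smooth_mat n A \<longleftrightarrow> (\<forall>p<n. \<forall>q<n. smooth (\<lambda>x. A x $$ (p, q)))"

definition smooth2_mat :: "nat \<Rightarrow> (real \<Rightarrow> real \<Rightarrow> real mat) \<Rightarrow> bool" where
  "smooth2_mat n A \<longleftrightarrow> (\<forall>p<n. \<forall>q<n. smooth2 (\<lambda>x t. A x t $$ (p, q)))"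

definition mat_deriv :: "nat \<Rightarrow> (real \<Rightarrow> real mat) \<Rightarrow> real \<Rightarrow> real mat" where
  "mat_deriv n A x = mat n n (\<lambda>(p, q). deriv (\<lambda>s. A s $$ (p, q)) x)"

definition vec_deriv :: "nat \<Rightarrow> (real \<Rightarrow> real vec) \<Rightarrow> real \<Rightarrow> real vec" where
  "vec_deriv n v x = vec n (\<lambda>p. deriv (\<lambda>s. v s $ p) x)"

section \<open>Matrices\<close>

definition SL :: "nat \<Rightarrow> real mat set" where
  "SL n = {A \<in> carrier_mat n n. det A = 1}"

definition sl :: "nat \<Rightarrow> real mat set" where
  "sl n = {A \<in> carrier_mat n n. (\<Sum>p<n. A $$ (p, p)) = 0}"

definition strictly_upper :: "nat \<Rightarrow> real mat set" where
  "strictly_upper n = {A \<in> carrier_mat n n. \<forall>p<n. \<forall>q\<le>p. A $$ (p, q) = 0}"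

text \<open>The matrix unit \<open>e\<^bsub>1n\<^esub>\<close> and the matrix \<open>b\<close>, the sum of the \<open>e\<^bsub>i+1,i\<^esub>\<close>.\<close>

definition e1n :: "nat \<Rightarrow> 'a :: {zero, one} mat" where
  "e1n n = mat n n (\<lambda>(p, q). if p = 0 \<and> q = n - 1 then 1 else 0)"

definition bmat :: "nat \<Rightarrow> 'a :: {zero, one} mat" where
  "bmat n = mat n n (\<lambda>(p, q). if p = q + 1 then 1 else 0)"

definition V :: "nat \<Rightarrow> real mat set" where
  "V n = {A \<in> carrier_mat n n. \<forall>p<n. \<forall>q<n. \<not> (p < n - 1 \<and> q = n - 1) \<longrightarrow> A $$ (p, q) = 0}"

definition comm :: "'a :: ring mat \<Rightarrow> 'a mat \<Rightarrow> 'a mat" where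
  "comm A B = A * B - B * A"

text \<open>\<open>dx_comm n A B\<close> is \<open>[\<partial>\<^sub>x + A, B] = B\<^sub>x + [A, B]\<close>.\<close>

definition dx_comm ::
  "nat \<Rightarrow> (real \<Rightarrow> real mat) \<Rightarrow> (real \<Rightarrow> real mat) \<Rightarrow> real \<Rightarrow> real mat" where
  "dx_comm n A B x = mat_deriv n B x + comm (A x) (B x)"

section \<open>The series \<open>Y\<close> and the matrices \<open>Z\<^bsub>j,0\<^esub>\<close>\<close>

text \<open>
  A formal series \<open>\<Sum>\<^bsub>i \<le> m\<^esub> A\<^sub>i \<lambda>\<^sup>i\<close> with matrix coefficients is a matrix over the formal Laurent
  series in \<open>X = \<lambda>\<^sup>-\<^sup>1\<close>; thus \<open>\<lambda>\<close> is \<^term>\<open>fls_X_inv\<close>, and the coefficient of \<open>\<lambda>\<^sup>i\<close> is the one of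
  \<open>X\<^sup>-\<^sup>i\<close>.
\<close>

abbreviation lam :: "real fls" where
  "lam \<equiv> fls_X_inv"

definition lam_coeff :: "int \<Rightarrow> real fls mat \<Rightarrow> real mat" where
  "lam_coeff i A = map_mat (\<lambda>f. fls_nth f (- i)) A"

definition Jmat :: "nat \<Rightarrow> real fls mat" where
  "Jmat n = lam \<cdot>\<^sub>m e1n n + bmat n"

definition is_Y :: "nat \<Rightarrow> (real \<Rightarrow> real mat) \<Rightarrow> (real \<Rightarrow> real fls mat) \<Rightarrow> bool" where
  "is_Y n u Y \<longleftrightarrow>
     (\<forall>x. Y x \<in> carrier_mat n n) \<and>
     (\<forall>i. smooth_mat n (\<lambda>x. lam_coeff i (Y x))) \<and>
     (\<forall>i x. lam_coeff i (Y x) \<in> sl n) \<and>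
     (\<forall>x. lam_coeff 1 (Y x) = e1n n) \<and>
     (\<forall>i>1. \<forall>x. lam_coeff i (Y x) = 0\<^sub>m n n) \<and>
     (\<forall>i x. mat_deriv n (\<lambda>s. lam_coeff i (Y s)) x
              + lam_coeff i (comm (Jmat n + map_mat fls_const (u x)) (Y x)) = 0\<^sub>m n n) \<and>
     (\<forall>x. Y x ^\<^sub>m n = lam \<cdot>\<^sub>m 1\<^sub>m n)"

definition Yser :: "nat \<Rightarrow> (real \<Rightarrow> real mat) \<Rightarrow> real \<Rightarrow> real fls mat" where
  "Yser n u = (THE Y. is_Y n u Y)"

definition Ycoeff :: "nat \<Rightarrow> nat \<Rightarrow> int \<Rightarrow> (real \<Rightarrow> real mat) \<Rightarrow> real \<Rightarrow> real mat" where
  "Ycoeff n j i u x = lam_coeff i (Yser n u x ^\<^sub>m j)"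

definition is_zeta ::
  "nat \<Rightarrow> nat \<Rightarrow> (real \<Rightarrow> real mat) \<Rightarrow> (real \<Rightarrow> real mat) \<Rightarrow> bool" where
  "is_zeta n j u \<zeta> \<longleftrightarrow>
     (\<forall>x. \<zeta> x \<in> strictly_upper n) \<and>
     smooth_mat n \<zeta> \<and>
     (\<forall>x. dx_comm n (\<lambda>s. bmat n + u s) (\<lambda>s. Ycoeff n j 0 u s - \<zeta> s) x \<in> V n)"

definition zeta :: "nat \<Rightarrow> nat \<Rightarrow> (real \<Rightarrow> real mat) \<Rightarrow> real \<Rightarrow> real mat" where
  "zeta n j u = (THE \<zeta>. is_zeta n j u \<zeta>)"

definition Z0 :: "nat \<Rightarrow> nat \<Rightarrow> (real \<Rightarrow> real mat) \<Rightarrow> real \<Rightarrow> real mat" where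
  "Z0 n j u x = Ycoeff n j 0 u x - zeta n j u x"

section \<open>The KdV flow\<close>

definition KdV_flow_solution :: "nat \<Rightarrow> nat \<Rightarrow> (real \<Rightarrow> real \<Rightarrow> real mat) \<Rightarrow> bool" where
  "KdV_flow_solution n j u \<longleftrightarrow>
     (\<forall>x t. u x t \<in> V n) \<and> smooth2_mat n u \<and>
     (\<forall>x t. mat_deriv n (\<lambda>s. u x s) t =
        dx_comm n (\<lambda>s. bmat n + u s t) (Z0 n j (\<lambda>s. u s t)) x)"

section \<open>Central affine curves and their flows\<close>

definition moving_frame :: "nat \<Rightarrow> (real \<Rightarrow> real vec) \<Rightarrow> real \<Rightarrow> real mat" where
  "moving_frame n \<gamma> x = mat n n (\<lambda>(p, k). (deriv ^^ k) (\<lambda>s. \<gamma> s $ p) x)"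

definition M :: "nat \<Rightarrow> (real \<Rightarrow> real vec) set" where
  "M n = {\<gamma>. (\<forall>x. \<gamma> x \<in> carrier_vec n - {0\<^sub>v n}) \<and> (\<forall>p<n. smooth (\<lambda>x. \<gamma> x $ p)) \<and>
             (\<forall>x. det (moving_frame n \<gamma> x) = 1)}"

definition curvature :: "nat \<Rightarrow> (real \<Rightarrow> real vec) \<Rightarrow> real \<Rightarrow> real mat" where
  "curvature n \<gamma> x = (THE A. A \<in> V n \<and>
     (\<forall>p<n. (deriv ^^ n) (\<lambda>s. \<gamma> s $ p) x =
        (\<Sum>i<n-1. A $$ (i, n - 1) * (deriv ^^ i) (\<lambda>s. \<gamma> s $ p) x)))"

definition curve_flow_solution :: "nat \<Rightarrow> nat \<Rightarrow> (real \<Rightarrow> real \<Rightarrow> real vec) \<Rightarrow> bool" where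
  "curve_flow_solution n j \<gamma> \<longleftrightarrow>
     (\<forall>p<n. smooth2 (\<lambda>x t. \<gamma> x t $ p)) \<and>
     (\<forall>t. (\<lambda>x. \<gamma> x t) \<in> M n) \<and>
     (\<forall>x t. vec_deriv n (\<lambda>s. \<gamma> x s) t =
        moving_frame n (\<lambda>s. \<gamma> s t) x * Z0 n j (curvature n (\<lambda>s. \<gamma> s t)) x *\<^sub>v unit_vec n 0)"

end

theory Submission
  imports Defs
begin

text \<open>
  Since \<open>u\<close> lives in the last column, \<open>g\<^sub>x = g (b + u)\<close> says that each column of \<open>g\<close> but the last
  has the next column as its derivative, so \<open>g\<close> is the moving frame of its first column \<open>\<gamma>\<close>. The last
  column of the equation then expresses \<open>\<gamma>\<^sub>x\<^sup>(\<^sup>n\<^sup>)\<close> through \<open>u\<close>, whose entries are determined because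
  \<open>g\<close> is invertible. The first column of \<open>g\<^sub>t = g Z\<^bsub>j,0\<^esub>(u)\<close> is the curve flow.
\<close>

text \<open>Unfolding the coinductive class once yields an x-derivative that again lies in it, so
  the step can be repeated. One \<open>h\<close> has to serve all \<open>t\<close> at once, because
  the next unfolding needs a function of both variables, not a single slice.\<close>

lemma smooth2_funpow_deriv:
  assumes "smooth2 f"
  shows "\<exists>h. smooth2 h \<and> (\<forall>t. (deriv ^^ k) (\<lambda>x. f x t) = (\<lambda>x. h x t))"
proof (induction k)
  case 0
  then show ?case using assms by auto
next
  case (Suc k)
  then obtain h where h: "smooth2 h" "\<And>t. (deriv ^^ k) (\<lambda>x. f x t) = (\<lambda>x. h x t)"
    by blast
  from h(1) obtain hx where hx: "smooth2 hx"
      "\<And>x t. ((\<lambda>s. h s t) has_real_derivative hx x t) (at x)"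
    by (cases rule: smooth2.cases) auto
  have "(deriv ^^ Suc k) (\<lambda>x. f x t) = (\<lambda>x. hx x t)" for t
    using h(2) hx(2) by (auto simp: DERIV_imp_deriv)
  with hx(1) show ?case by blast
qed

lemma smooth2_imp_smooth:
  assumes "smooth2 f"
  shows "smooth (\<lambda>x. f x t)"
  unfolding smooth_def
proof (intro allI)
  fix k x
  obtain h where h: "smooth2 h" "(deriv ^^ k) (\<lambda>x. f x t) = (\<lambda>x. h x t)"
    using smooth2_funpow_deriv[OF assms] by blast
  from h(1) show "(deriv ^^ k) (\<lambda>x. f x t) differentiable (at x)"
    unfolding h(2) by (cases rule: smooth2.cases) (auto simp: real_differentiable_def)
qed

lemma mult_mat_unit_vec_0:
  fixes A :: "real mat"
  assumes "A \<in> carrier_mat m n" and "0 < n" and "p < m"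
  shows "(A *\<^sub>v unit_vec n 0) $ p = A $$ (p, 0)"
  using assms by auto

text \<open>Right multiplication by \<open>bmat n\<close> moves every column one place to the left
  and leaves zeros in the last one; an element of \<open>V n\<close> contributes to the last column
  only. So the two summands never meet in the same column.\<close>

lemma mult_bmat_plus_V_index:
  assumes A: "A \<in> carrier_mat n n" and u: "u \<in> V n" and p: "p < n"
  shows "Suc q < n \<Longrightarrow> (A * (bmat n + u)) $$ (p, q) = A $$ (p, Suc q)"
    and "0 < n \<Longrightarrow> (A * (bmat n + u)) $$ (p, n - 1) = (\<Sum>i<n-1. u $$ (i, n - 1) * A $$ (p, i))"
proof -
  have uc: "u \<in> carrier_mat n n"
    and u0: "\<And>i k. i < n \<Longrightarrow> k < n \<Longrightarrow> \<not> (i < n - 1 \<and> k = n - 1) \<Longrightarrow> u $$ (i, k) = 0"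
    using u unfolding V_def by auto
  have entry: "(A * (bmat n + u)) $$ (p, q)
      = (\<Sum>i<n. A $$ (p, i) * ((if i = q + 1 then 1 else 0) + u $$ (i, q)))" if "q < n" for q
    using A uc p that
    by (auto simp: scalar_prod_def bmat_def lessThan_atLeast0 intro!: sum.cong)
  show "(A * (bmat n + u)) $$ (p, q) = A $$ (p, Suc q)" if q: "Suc q < n"
  proof -
    have u_col: "u $$ (i, q) = 0" if "i < n" for i
      using q that by (intro u0) auto
    have "(A * (bmat n + u)) $$ (p, q)
        = (\<Sum>i<n. A $$ (p, i) * ((if i = q + 1 then 1 else 0) + u $$ (i, q)))"
      using q by (intro entry) simp
    also have "\<dots> = (\<Sum>i<n. if i = Suc q then A $$ (p, i) else 0)"
      using u_col by (intro sum.cong) auto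
    finally have "(A * (bmat n + u)) $$ (p, q) = (\<Sum>i<n. if i = Suc q then A $$ (p, i) else 0)" .
    then show ?thesis using q by simp
  qed
  show "(A * (bmat n + u)) $$ (p, n - 1) = (\<Sum>i<n-1. u $$ (i, n - 1) * A $$ (p, i))"
    if n: "0 < n"
  proof -
    from n obtain m where m: "n = Suc m" by (cases n) auto
    \<comment> \<open>In this column the 1 of \<open>bmat n\<close> would have to stand in row
      \<open>n\<close>, which is out of range.\<close>
    have "(A * (bmat n + u)) $$ (p, n - 1) = (\<Sum>i<n. A $$ (p, i) * u $$ (i, n - 1))"
      using n by (subst entry) (auto intro!: sum.cong)
    \<comment> \<open>The lower right corner of \<open>u\<close> is zero, which removes the last
      term.\<close>
    also have "\<dots> = (\<Sum>i<n-1. u $$ (i, n - 1) * A $$ (p, i))"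
      using u0[of m m] unfolding m by (simp add: mult.commute)
    finally show ?thesis .
  qed
qed

lemma moving_frame_first_column:
  fixes g u :: "real \<Rightarrow> real mat"
  assumes g: "\<And>x. g x \<in> carrier_mat n n" and u: "\<And>x. u x \<in> V n" and n: "0 < n"
    and ode: "\<And>x. mat_deriv n g x = g x * (bmat n + u x)"
  defines "\<gamma> \<equiv> \<lambda>x. g x *\<^sub>v unit_vec n 0"
  shows "moving_frame n \<gamma> = g"
    and "p < n \<Longrightarrow> (deriv ^^ n) (\<lambda>s. \<gamma> s $ p) x = (\<Sum>i<n-1. u x $$ (i, n - 1) * g x $$ (p, i))"
    and "p < n \<Longrightarrow> k < n \<Longrightarrow> (deriv ^^ k) (\<lambda>s. \<gamma> s $ p) = (\<lambda>x. g x $$ (p, k))"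
proof -
  have der: "deriv (\<lambda>s. g s $$ (p, q)) x = (g x * (bmat n + u x)) $$ (p, q)"
    if "p < n" "q < n" for p q x
    using that unfolding ode[symmetric] by (simp add: mat_deriv_def)
  \<comment> \<open>The bound on \<open>k\<close> goes through the induction, since the column shift
    stops at column \<open>n - 1\<close>. The \<open>n\<close>-th derivative differentiates that
    column once more and so meets the last column of the equation.\<close>
  have col: "(deriv ^^ k) (\<lambda>s. \<gamma> s $ p) = (\<lambda>x. g x $$ (p, k))" if "p < n" "k < n" for p k
    using that(2)
  proof (induction k)
    case 0
    then show ?case
      using mult_mat_unit_vec_0[OF g n that(1)] by (simp add: \<gamma>_def)
  next
    case (Suc k)
    then show ?case
      using that(1) by (auto simp: der mult_bmat_plus_V_index(1)[OF g u])
  qed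
  then show "p < n \<Longrightarrow> k < n \<Longrightarrow> (deriv ^^ k) (\<lambda>s. \<gamma> s $ p) = (\<lambda>x. g x $$ (p, k))" .
  show "moving_frame n \<gamma> = g"
  proof
    fix x
    show "moving_frame n \<gamma> x = g x"
      using g[of x] by (intro eq_matI) (auto simp: moving_frame_def col)
  qed
  show "(deriv ^^ n) (\<lambda>s. \<gamma> s $ p) x = (\<Sum>i<n-1. u x $$ (i, n - 1) * g x $$ (p, i))" if p: "p < n"
  proof -
    from n obtain m where m: "n = Suc m" by (cases n) auto
    have "(deriv ^^ n) (\<lambda>s. \<gamma> s $ p) x = deriv ((deriv ^^ (n - 1)) (\<lambda>s. \<gamma> s $ p)) x"
      unfolding m by simp
    also have "\<dots> = deriv (\<lambda>s. g s $$ (p, n - 1)) x"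
      using p n by (simp add: col)
    also have "\<dots> = (\<Sum>i<n-1. u x $$ (i, n - 1) * g x $$ (p, i))"
      using der[OF p, of "n - 1"] mult_bmat_plus_V_index(2)[OF g u p n] n by simp
    finally show ?thesis .
  qed
qed

lemma V_eqI_of_det_nonzero:
  fixes g :: "real mat"
  assumes g: "g \<in> carrier_mat n n" "det g \<noteq> 0" and A: "A \<in> V n" and B: "B \<in> V n"
    and eq: "\<And>p. p < n \<Longrightarrow> (\<Sum>i<n-1. A $$ (i, n - 1) * g $$ (p, i))
      = (\<Sum>i<n-1. B $$ (i, n - 1) * g $$ (p, i))"
  shows "A = B"
proof -
  \<comment> \<open>The hypothesis \<open>eq\<close> puts this difference of last columns into the
    kernel of \<open>g\<close>: its last entry is zero for elements of \<open>V n\<close>, so the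
    sums up to \<open>n - 1\<close> are full matrix-vector products.\<close>
  define v where "v = vec n (\<lambda>i. A $$ (i, n - 1) - B $$ (i, n - 1))"
  have AB: "A \<in> carrier_mat n n" "B \<in> carrier_mat n n"
    and A0: "\<And>i k. i < n \<Longrightarrow> k < n \<Longrightarrow> \<not> (i < n - 1 \<and> k = n - 1) \<Longrightarrow> A $$ (i, k) = 0"
    and B0: "\<And>i k. i < n \<Longrightarrow> k < n \<Longrightarrow> \<not> (i < n - 1 \<and> k = n - 1) \<Longrightarrow> B $$ (i, k) = 0"
    using A B unfolding V_def by auto
  have v: "v \<in> carrier_vec n" by (simp add: v_def)
  have "g *\<^sub>v v = 0\<^sub>v n"
  proof (rule eq_vecI)
    fix p assume "p < dim_vec (0\<^sub>v n :: real vec)"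
    then have p: "p < n" by simp
    then obtain m where m: "n = Suc m" by (cases n) auto
    have "(g *\<^sub>v v) $ p = (\<Sum>i<n. (A $$ (i, n - 1) - B $$ (i, n - 1)) * g $$ (p, i))"
      using g p by (auto simp: v_def scalar_prod_def lessThan_atLeast0 intro!: sum.cong)
    also have "\<dots> = (\<Sum>i<n-1. (A $$ (i, n - 1) - B $$ (i, n - 1)) * g $$ (p, i))"
      using A0[of m m] B0[of m m] unfolding m by simp
    also have "\<dots> = 0"
      using eq[OF p] by (simp add: left_diff_distrib sum_subtractf)
    finally show "(g *\<^sub>v v) $ p = 0\<^sub>v n $ p" using p by simp
  qed (use g in auto)
  then have "v = 0\<^sub>v n"
    using det_0_iff_vec_prod_zero_field[OF g(1)] g(2) v by blast
  then have last: "A $$ (i, n - 1) = B $$ (i, n - 1)" if "i < n" for i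
    using that index_vec[of i n "\<lambda>i. A $$ (i, n - 1) - B $$ (i, n - 1)"] by (simp add: v_def)
  show ?thesis
  proof (rule eq_matI)
    fix i k assume "i < dim_row B" "k < dim_col B"
    then show "A $$ (i, k) = B $$ (i, k)"
      using AB A0[of i k] B0[of i k] last[of i] by (cases "k = n - 1") auto
  qed (use AB in auto)
qed

text \<open>The formula for the \<open>n\<close>-th derivative of the first column makes
  \<open>u x\<close> a candidate for the definite description, and the invertibility of
  \<open>g x\<close> excludes any other.\<close>

lemma curvature_first_column:
  fixes g u :: "real \<Rightarrow> real mat"
  assumes g: "\<And>x. g x \<in> SL n" and u: "\<And>x. u x \<in> V n" and n: "0 < n"
    and ode: "\<And>x. mat_deriv n g x = g x * (bmat n + u x)"
  shows "curvature n (\<lambda>x. g x *\<^sub>v unit_vec n 0) = u"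
proof
  fix x
  have gc: "\<And>x. g x \<in> carrier_mat n n" and det: "det (g x) = 1"
    using g by (auto simp: SL_def)
  note frame = moving_frame_first_column[OF gc u n ode]
  have deriv_n: "(\<Sum>i<n-1. A $$ (i, n - 1) * (deriv ^^ i) (\<lambda>s. (g s *\<^sub>v unit_vec n 0) $ p) x)
      = (\<Sum>i<n-1. A $$ (i, n - 1) * g x $$ (p, i))" if "p < n" for A p
    using that by (intro sum.cong) (auto simp: frame(3))
  show "curvature n (\<lambda>x. g x *\<^sub>v unit_vec n 0) x = u x"
    unfolding curvature_def
  proof (rule the_equality)
    fix A assume "A \<in> V n \<and> (\<forall>p<n. (deriv ^^ n) (\<lambda>s. (g s *\<^sub>v unit_vec n 0) $ p) x =
        (\<Sum>i<n-1. A $$ (i, n - 1) * (deriv ^^ i) (\<lambda>s. (g s *\<^sub>v unit_vec n 0) $ p) x))"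
    then show "A = u x"
      using det by (intro V_eqI_of_det_nonzero[OF gc[of x]]) (auto simp: u deriv_n frame(2) simp del: One_nat_def)
  qed (auto simp: u deriv_n frame(2) simp del: One_nat_def)
qed

theorem theorem3p1:
  fixes n j :: nat
    and u :: "real \<Rightarrow> real \<Rightarrow> real mat"
    and c0 :: "real mat"
    and g :: "real \<Rightarrow> real \<Rightarrow> real mat"
    and \<gamma> :: "real \<Rightarrow> real \<Rightarrow> real vec"
  assumes "n \<ge> 2" and "j \<ge> 1" and "j mod n \<noteq> 0"
    and "KdV_flow_solution n j u"
    and "c0 \<in> SL n"
    and "\<And>x t. g x t \<in> SL n"
    and "smooth2_mat n g"
    and "\<And>x t. mat_deriv n (\<lambda>s. g s t) x = g x t * (bmat n + u x t)"
    and "\<And>x t. mat_deriv n (\<lambda>s. g x s) t = g x t * Z0 n j (\<lambda>s. u s t) x"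
    and "g 0 0 = c0"
    and "\<And>x t. \<gamma> x t = g x t *\<^sub>v unit_vec n 0"
  shows "curve_flow_solution n j \<gamma> \<and> (\<forall>t. curvature n (\<lambda>x. \<gamma> x t) = (\<lambda>x. u x t))"
proof -
  have n: "0 < n" using assms(1) by simp
  have u: "\<And>x t. u x t \<in> V n" using assms(4) by (simp add: KdV_flow_solution_def)
  have gc: "\<And>x t. g x t \<in> carrier_mat n n" and det: "\<And>x t. det (g x t) = 1"
    using assms(6) by (auto simp: SL_def)
  \<comment> \<open>An equality of functions of \<open>x\<close>, not just of values:
    \<open>Z0\<close> depends on the whole slice, and this lets it be evaluated at the curvature of
    the curve.\<close>
  have curv: "curvature n (\<lambda>x. \<gamma> x t) = (\<lambda>x. u x t)" for t
    unfolding assms(11) using assms(6) u n assms(8) by (rule curvature_first_column)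
  have frame: "moving_frame n (\<lambda>x. \<gamma> x t) = (\<lambda>x. g x t)" for t
    unfolding assms(11) using gc u n assms(8) by (rule moving_frame_first_column(1))
  have entry: "\<gamma> x t $ p = g x t $$ (p, 0)" if "p < n" for x t p
    unfolding assms(11) using gc n that by (rule mult_mat_unit_vec_0)
  have smooth2: "smooth2 (\<lambda>x t. \<gamma> x t $ p)" if "p < n" for p
    using assms(7) n that by (simp add: entry smooth2_mat_def)
  have "(\<lambda>x. \<gamma> x t) \<in> M n" for t
  proof -
    have "\<gamma> x t \<noteq> 0\<^sub>v n" for x
    proof
      assume "\<gamma> x t = 0\<^sub>v n"
      \<comment> \<open>A zero of \<open>\<gamma>\<close> would put the first unit vector into the
        kernel of a matrix of determinant 1.\<close>
      then have "unit_vec n 0 = (0\<^sub>v n :: real vec)"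
        using det_0_iff_vec_prod_zero_field[OF gc[of x t]] det[of x t] unfolding assms(11)
        by (metis unit_vec_carrier zero_neq_one)
      then show False using n by (simp add: unit_vec_nonzero)
    qed
    moreover have "\<gamma> x t \<in> carrier_vec n" for x
      using gc[of x t] by (simp add: assms(11))
    ultimately show ?thesis
      using smooth2_imp_smooth[OF smooth2] det by (simp add: M_def frame)
  qed
  moreover have "vec_deriv n (\<lambda>s. \<gamma> x s) t =
      moving_frame n (\<lambda>s. \<gamma> s t) x * Z0 n j (curvature n (\<lambda>s. \<gamma> s t)) x *\<^sub>v unit_vec n 0" for x t
  proof -
    \<comment> \<open>Differentiation in \<open>t\<close> is entrywise and so commutes with taking
      the first column; the t-equation for \<open>g\<close> then gives the flow.\<close>
    have "vec_deriv n (\<lambda>s. \<gamma> x s) t = mat_deriv n (\<lambda>s. g x s) t *\<^sub>v unit_vec n 0"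
      using n by (intro eq_vecI) (auto simp: vec_deriv_def mat_deriv_def entry)
    then show ?thesis by (simp add: assms(9) frame curv)
  qed
  ultimately show ?thesis
    using smooth2 curv by (simp add: curve_flow_solution_def)
qed

end
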